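(* Let $x_0<x_1$ be real numbers, let $I$ be the interval $x_0\leq x\leq x_1$, and let $y$ be a solution on $I$ of the initial value problem $y'=f(x,y)$, $y(x_0)=y_0$. Suppose that $f(x,y(x))>0$ for all $x\in I$, and that the differential inequality $$y'(x)\leq f(x_1,y(x))$$ also holds for all $x\in I$. Then the integral inequality $$\int_{x_0}^{x}\left\{\frac{1}{f(x_1,y(t))}\,\frac{dy}{dt}\right\}dt\leq x-x_0$$ holds for all $x\in I$.
   Context: Here $x_0,y_0$ are real, and $f$ is a real function given by a power series $f(x,y)=\sum_{i,j}A_{ij}(x-x_0)^i(y-y_0)^j$ convergent for $|x-x_0|<R_1$, $|y-y_0|<R_2$, where $R_1,R_2>0$ (possibly infinite). It is understood that $x_1-x_0<R_1$ and that $|y(x)-y_0|<R_2$ for all $x\in I$, so that $f(x,y(x))$ and $f(x_1,y(x))$ are defined for all $x\in I$. *)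

theory Defs
  imports "HOL-Analysis.Analysis"
begin

end

theory Submission imports Defs begin

text \<open>
  The integrand \<open>y'(t) / f(x1, y(t))\<close> is at most \<open>1\<close>: the differential inequality gives
  \<open>0 < y'(t) \<le> f(x1, y(t))\<close>. Integrating this bound over \<open>[x0, x]\<close> gives the claim, provided
  that the integrand is integrable; this is the only point that needs an argument.

  The solution has a positive derivative, so it increases from \<open>y0\<close>, and by the intermediate value
  theorem every \<open>v \<in> [y0, y(x)]\<close> is a value \<open>y(t)\<close>. Hence \<open>v \<mapsto> f(x1, v)\<close> is positive on
  \<open>[y0, y(x)]\<close>. It is also continuous there, being a power series in \<open>v\<close> that converges uniformly
  by the Weierstrass test (\<open>continuous_on_double_power_series_slice\<close>). The substitution
  \<open>v = y(t)\<close> then shows that the integral exists, with value \<open>\<integral> dv / f(x1, v)\<close> over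
  \<open>[y0, y(x)]\<close> (\<open>monotone_substitution_inverse\<close>).
\<close>

text \<open>
  On \<open>\<bar>w\<bar> \<le> r\<close> each term is dominated by the absolute value of the term at \<open>w = r\<close>. Convergence
  at that single point is therefore enough, because an unordered sum of reals converges
  absolutely.
\<close>

lemma continuous_on_double_power_series_slice:
  fixes A :: "nat \<Rightarrow> nat \<Rightarrow> real" and s r :: real
  assumes r: "(\<lambda>(i, j). A i j * s ^ i * r ^ j) summable_on UNIV"
  shows "continuous_on {-r..r} (\<lambda>w. \<Sum>\<^sub>\<infinity>(i, j). A i j * s ^ i * w ^ j)"
proof -
  let ?term = "\<lambda>(i, j) w. A i j * s ^ i * w ^ j"
  have bound: "norm (?term p w) \<le> \<bar>?term p r\<bar>" if "w \<in> {-r..r}" for p w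
  proof -
    obtain i j where p: "p = (i, j)" by fastforce
    have "\<bar>w\<bar> ^ j \<le> \<bar>r\<bar> ^ j" using that by (intro power_mono) auto
    then show ?thesis by (simp add: p abs_mult power_abs mult_left_mono)
  qed
  have "(\<lambda>p. \<bar>?term p r\<bar>) summable_on UNIV"
    using r summable_on_iff_abs_summable_on_real[of "\<lambda>p. ?term p r" UNIV]
    by (simp add: case_prod_unfold)
  with bound have lim: "uniform_limit {-r..r} (\<lambda>X w. \<Sum>p\<in>X. ?term p w)
      (\<lambda>w. \<Sum>\<^sub>\<infinity>p\<in>UNIV. ?term p w) (finite_subsets_at_top UNIV)"
    by (intro Weierstrass_m_test_general) auto
  have "continuous_on {-r..r} (\<lambda>w. \<Sum>\<^sub>\<infinity>p\<in>UNIV. ?term p w)"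
    by (rule uniform_limit_theorem[OF _ lim])
       (auto simp: case_prod_unfold intro!: always_eventually continuous_intros)
  then show ?thesis by (simp add: case_prod_unfold)
qed

text \<open>
  That \<open>g\<close> is nonzero is given only along \<open>y\<close>, but substitution needs \<open>1 / g\<close> to be continuous on
  the whole target interval. Since \<open>y\<close> is increasing and continuous it maps \<open>[a, b]\<close> onto
  \<open>[y(a), y(b)]\<close>, and so \<open>g\<close> has no zero there.
\<close>

lemma monotone_substitution_inverse:
  fixes y y' g :: "real \<Rightarrow> real"
  assumes "a \<le> b"
    and deriv: "\<And>t. t \<in> {a..b} \<Longrightarrow> (y has_real_derivative y' t) (at t within {a..b})"
    and nonneg: "\<And>t. t \<in> {a..b} \<Longrightarrow> 0 \<le> y' t"
    and g_nonzero: "\<And>t. t \<in> {a..b} \<Longrightarrow> g (y t) \<noteq> 0"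
    and g_cont: "continuous_on {y a..y b} g"
  shows "((\<lambda>t. 1 / g (y t) * y' t) has_integral integral {y a..y b} (\<lambda>v. 1 / g v)) {a..b}"
proof -
  have y_cont: "continuous_on {a..b} y"
    by (rule DERIV_continuous_on[OF deriv])
  have mono: "y s \<le> y t" if "s \<in> {a..b}" "t \<in> {a..b}" "s \<le> t" for s t
  proof (rule DERIV_nonneg_imp_increasing_open[OF \<open>s \<le> t\<close>])
    show "continuous_on {s..t} y"
      using y_cont by (rule continuous_on_subset) (use that in auto)
    fix z assume z: "s < z" "z < t"
    then have "z \<in> interior {a..b}" using that by auto
    then have "(y has_real_derivative y' z) (at z)"
      using deriv[of z] at_within_interior[of z "{a..b}"] z that by auto
    then show "\<exists>d. (y has_real_derivative d) (at z) \<and> 0 \<le> d"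
      using nonneg[of z] z that by auto
  qed
  have "g v \<noteq> 0" if "v \<in> {y a..y b}" for v
    using IVT'[of y a v b] that \<open>a \<le> b\<close> y_cont g_nonzero by force
  then have "continuous_on {y a..y b} (\<lambda>v. 1 / g v)"
    by (intro continuous_intros g_cont) auto
  moreover have "y ` {a..b} \<subseteq> {y a..y b}"
    using mono \<open>a \<le> b\<close> by auto
  ultimately have "((\<lambda>t. y' t *\<^sub>R (1 / g (y t))) has_integral
      integral {y a..y b} (\<lambda>v. 1 / g v)) {a..b}"
    using \<open>a \<le> b\<close> mono deriv by (intro has_integral_substitution) auto
  then show ?thesis by (simp add: mult.commute)
qed

theorem theorem1:
  fixes f :: "real \<Rightarrow> real \<Rightarrow> real"
    and A :: "nat \<Rightarrow> nat \<Rightarrow> real"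
    and R1 R2 :: ereal
    and x0 y0 x1 :: real
    and y y' :: "real \<Rightarrow> real"
  assumes radii: "0 < R1" "0 < R2"
    and series: "\<And>u v. ereal \<bar>u - x0\<bar> < R1 \<Longrightarrow> ereal \<bar>v - y0\<bar> < R2 \<Longrightarrow>
                   ((\<lambda>(i, j). A i j * (u - x0) ^ i * (v - y0) ^ j) has_sum f u v) UNIV"
    and less: "x0 < x1"
    and x1_dom: "ereal (x1 - x0) < R1"
    and y_dom: "\<And>x. x \<in> {x0..x1} \<Longrightarrow> ereal \<bar>y x - y0\<bar> < R2"
    and deriv: "\<And>x. x \<in> {x0..x1} \<Longrightarrow> (y has_real_derivative y' x) (at x within {x0..x1})"
    and ode: "\<And>x. x \<in> {x0..x1} \<Longrightarrow> y' x = f x (y x)"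
    and init: "y x0 = y0"
    and pos: "\<And>x. x \<in> {x0..x1} \<Longrightarrow> f x (y x) > 0"
    and ineq: "\<And>x. x \<in> {x0..x1} \<Longrightarrow> y' x \<le> f x1 (y x)"
  shows "\<forall>x\<in>{x0..x1}.
           (\<lambda>t. 1 / f x1 (y t) * y' t) integrable_on {x0..x} \<and>
           integral {x0..x} (\<lambda>t. 1 / f x1 (y t) * y' t) \<le> x - x0"
proof (intro ballI conjI)
  fix x assume x: "x \<in> {x0..x1}"
  \<comment> \<open>\<open>?r\<close> is less than \<open>R2\<close>, and the closed interval of this radius around \<open>y0\<close> contains
    \<open>[y0, y(x)]\<close>.\<close>
  let ?g = "\<lambda>v. f x1 v" and ?r = "\<bar>y x - y0\<bar>"
  have f_sum: "((\<lambda>(i, j). A i j * (x1 - x0) ^ i * w ^ j) has_sum f x1 (y0 + w)) UNIV"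
    if "w \<in> {-?r..?r}" for w
  proof -
    have "ereal \<bar>w\<bar> \<le> ereal ?r" using that by auto
    also have "\<dots> < R2" by (rule y_dom[OF x])
    finally show ?thesis using series[of x1 "y0 + w"] x1_dom less by simp
  qed
  have "continuous_on {-?r..?r} (\<lambda>w. \<Sum>\<^sub>\<infinity>(i, j). A i j * (x1 - x0) ^ i * w ^ j)"
    using f_sum[of ?r]
    by (intro continuous_on_double_power_series_slice) (auto intro: has_sum_imp_summable)
  then have "continuous_on {-?r..?r} (\<lambda>w. f x1 (y0 + w))"
    by (rule continuous_on_eq) (rule infsumI[OF f_sum])
  then have "continuous_on {y x0..y x} (\<lambda>v. f x1 (y0 + (v - y0)))"
    by (rule continuous_on_compose2) (auto simp: init intro!: continuous_intros)
  then have g_cont: "continuous_on {y x0..y x} ?g" by simp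
  have y'_pos: "0 < y' t" if "t \<in> {x0..x}" for t
    using ode[of t] pos[of t] that x by auto
  have y'_le: "y' t \<le> ?g (y t)" if "t \<in> {x0..x}" for t
    using ineq[of t] that x by auto
  have "((\<lambda>t. 1 / ?g (y t) * y' t) has_integral
      integral {y x0..y x} (\<lambda>v. 1 / ?g v)) {x0..x}"
  proof (rule monotone_substitution_inverse)
    fix t assume t: "t \<in> {x0..x}"
    show "(y has_real_derivative y' t) (at t within {x0..x})"
      by (rule DERIV_subset[OF deriv]) (use t x in auto)
    show "0 \<le> y' t" using y'_pos[OF t] by simp
    show "?g (y t) \<noteq> 0" using y'_pos[OF t] y'_le[OF t] by simp
  qed (use x g_cont in auto)
  then show "(\<lambda>t. 1 / f x1 (y t) * y' t) integrable_on {x0..x}"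
    by (rule has_integral_integrable)
  then have "integral {x0..x} (\<lambda>t. 1 / f x1 (y t) * y' t) \<le> integral {x0..x} (\<lambda>t. 1)"
  proof (rule integral_le)
    fix t assume t: "t \<in> {x0..x}"
    show "1 / f x1 (y t) * y' t \<le> 1"
      using y'_pos[OF t] y'_le[OF t] by (simp add: divide_le_eq)
  qed auto
  then show "integral {x0..x} (\<lambda>t. 1 / f x1 (y t) * y' t) \<le> x - x0"
    using x by simp
qed

end
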